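(* Let $\nu>-1/2$, $0\le|\beta|<\alpha$, $\mu\in\mathbb{R}$ and let $X\sim\mathrm{VG}(\nu,\alpha,\beta,\mu)$. For each integer $k\ge 0$ put $p=p_k:=\lceil k/2\rceil+1/2$ and $q=q_k:=k\bmod 2\in\{0,1\}$. Then, for every $r\in\{2,4,6,\ldots\}$, $$\mathbb{E}[|X|^r]=\frac{(1-\beta^2/\alpha^2)^{\nu+1/2}}{\sqrt{\pi}\,\alpha^r\,\Gamma(\nu+1/2)}\sum_{k=0}^r\binom{r}{k}2^k(\alpha\mu)^{r-k}\Big(\frac{2\beta}{\alpha}\Big)^{q_k}\Gamma(\nu+p_k)\Gamma(p_k)\,{}_2F_1\Big(p_k,\nu+p_k;\tfrac12+q_k;\tfrac{\beta^2}{\alpha^2}\Big).$$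
   Context: $\mathrm{VG}(\nu,\alpha,\beta,\mu)$ denotes the variance-gamma distribution, with probability density function on $\mathbb{R}$ $$p(x)=\frac{(\alpha^2-\beta^2)^{\nu+1/2}}{\sqrt{\pi}(2\alpha)^\nu\Gamma(\nu+1/2)}\,\mathrm{e}^{\beta(x-\mu)}|x-\mu|^\nu K_\nu(\alpha|x-\mu|),$$ where $K_\nu$ is the modified Bessel function of the second kind. ${}_2F_1$ is the Gauss hypergeometric function. Convention: $0^0=1$. *)

theory Defs
  imports "HOL-Probability.Probability"
begin

text \<open>
  Modified Bessel function of the second kind, by its integral representation; the integral
  converges for every real order \<open>\<nu>\<close> and every \<open>x > 0\<close>.
\<close>
definition bessel_K :: "real \<Rightarrow> real \<Rightarrow> real" where
  "bessel_K \<nu> x = (LBINT t:{0..}. exp (- x * cosh t) * cosh (\<nu> * t))"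

text \<open>
  Gauss hypergeometric series, meaningful for \<open>\<bar>z\<bar> < 1\<close> and \<open>c\<close> not a nonpositive integer.
\<close>
definition hyp2F1 :: "real \<Rightarrow> real \<Rightarrow> real \<Rightarrow> real \<Rightarrow> real" where
  "hyp2F1 a b c z =
     (\<Sum>j. pochhammer a j * pochhammer b j / pochhammer c j * (z ^ j / fact j))"

text \<open>The value at the single point \<open>x = \<mu>\<close> is a junk value and does not affect the law.\<close>
definition vg_density :: "real \<Rightarrow> real \<Rightarrow> real \<Rightarrow> real \<Rightarrow> real \<Rightarrow> real" where
  "vg_density \<nu> \<alpha> \<beta> \<mu> x =
     (\<alpha>\<^sup>2 - \<beta>\<^sup>2) powr (\<nu> + 1/2) / (sqrt pi * (2 * \<alpha>) powr \<nu> * Gamma (\<nu> + 1/2))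
     * exp (\<beta> * (x - \<mu>)) * \<bar>x - \<mu>\<bar> powr \<nu> * bessel_K \<nu> (\<alpha> * \<bar>x - \<mu>\<bar>)"

definition vg_p :: "nat \<Rightarrow> real" where
  "vg_p k = of_int \<lceil>real k / 2\<rceil> + 1/2"

definition vg_q :: "nat \<Rightarrow> nat" where
  "vg_q k = k mod 2"

end

theory Submission
  imports Defs "HOL-Real_Asymp.Real_Asymp"
begin

text \<open>
  Writing \<open>K\<^sub>\<nu>\<close> as \<open>\<integral> e\<^bsup>-x cosh t\<^esup> cosh (\<nu> t) dt\<close> and exchanging integrals reduces its Mellin
  transform to a Gamma integral in \<open>y\<close> followed by \<open>\<integral> cosh (\<nu> t) / cosh\<^sup>s t dt\<close>, which the
  substitution \<open>u = 1 / (1 + e\<^bsup>-2t\<^esup>)\<close> turns into a Beta integral. Folding the line at \<open>\<mu>\<close>, the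
  \<open>k\<close>-th central moment becomes a half-line integral of \<open>y\<^sup>k\<close> times \<open>cosh (\<beta> y)\<close> or \<open>sinh (\<beta> y)\<close>,
  according to the parity of \<open>k\<close>. Expanding the hyperbolic function leaves only even moments
  of \<open>y\<^bsup>\<nu>\<^esup> K\<^sub>\<nu>(\<alpha> y)\<close>, and integrating term by term produces the hypergeometric series in
  \<open>\<beta>\<^sup>2/\<alpha>\<^sup>2\<close>. The binomial theorem then shifts the centre from \<open>\<mu>\<close> to \<open>0\<close>.
\<close>

section \<open>Gamma and Beta integrals\<close>

lemma has_bochner_integral_Gamma_scaled:
  fixes s c :: real
  assumes "s > 0" "c > 0"
  shows "has_bochner_integral lborel
    (\<lambda>y. indicator {0<..} y * (y powr (s - 1) * exp (- c * y))) (Gamma s / c powr s)"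
proof -
  have "has_bochner_integral lborel (\<lambda>t. indicator {0..} t * t powr (s - 1) / exp t) (Gamma s)"
    using assms by (intro has_bochner_integral_nn_integral)
      (auto simp: Gamma_conv_nn_integral_real Gamma_real_pos less_imp_le)
  then have "has_bochner_integral lborel
      (\<lambda>y. indicator {0..} (0 + c * y) * (0 + c * y) powr (s - 1) / exp (0 + c * y)) (Gamma s /\<^sub>R \<bar>c\<bar>)"
    using assms by (subst (asm) lborel_has_bochner_integral_real_affine_iff[of c _ _ 0]) auto
  from has_bochner_integral_mult_right[OF this, of "c powr (1 - s)"]
  have "has_bochner_integral lborel
      (\<lambda>y. c powr (1 - s) * (indicator {0..} (0 + c * y) * (0 + c * y) powr (s - 1) / exp (0 + c * y)))
      (c powr (1 - s) * (Gamma s /\<^sub>R \<bar>c\<bar>))" by blast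
  also have "c powr (1 - s) * (Gamma s /\<^sub>R \<bar>c\<bar>) = Gamma s / c powr s"
    using assms by (simp add: powr_diff field_simps)
  \<comment> \<open>At \<open>y = 0\<close> both sides vanish because
    \<open>0 powr (s - 1) = 0\<close>, so the closed and the open half-line give the same
    function.\<close>
  also have "(\<lambda>y. c powr (1 - s) * (indicator {0..} (0 + c * y) * (0 + c * y) powr (s - 1) / exp (0 + c * y))) =
    (\<lambda>y. indicator {0<..} y * (y powr (s - 1) * exp (- c * y)))"
    using assms
    by (auto simp: fun_eq_iff powr_mult powr_diff exp_minus field_simps zero_le_mult_iff split: split_indicator)
  finally show ?thesis .
qed

text \<open>With the logistic substitution \<open>u = g t\<close> one has u = exp t / (2 cosh t), 1
  - u = exp (-t) / (2 cosh t) and du = 2 u (1 - u) dt, so the Beta integrand becomes 2 exp ((a - b)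
  t) / (2 cosh t) powr (a + b).\<close>

lemma has_bochner_integral_cosh_powr_exp:
  fixes a b :: real
  assumes "a > 0" "b > 0"
  shows "has_bochner_integral lborel (\<lambda>t. exp ((a - b) * t) / cosh t powr (a + b))
    (2 powr (a + b - 1) * Beta a b)"
proof -
  define g :: "real \<Rightarrow> real" where "g = (\<lambda>t. 1 / (1 + exp (- 2 * t)))"
  define g' :: "real \<Rightarrow> real" where "g' = (\<lambda>t. 2 * exp (- 2 * t) / (1 + exp (- 2 * t))\<^sup>2)"
  define f where "f = (\<lambda>u::real. u powr (a - 1) * (1 - u) powr (b - 1))"
  have nz: "1 + exp (- 2 * t) > 0" for t :: real
    by (simp add: add_pos_pos)
  have der: "(g has_field_derivative g' t) (at t within S)" for t S
    unfolding g_def g'_def using nz[of t]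
    by (auto intro!: derivative_eq_intros simp: power2_eq_square)
  have inj: "inj g"
    by (auto simp: inj_def g_def)
  have range: "range g = {0<..<1}"
  proof (intro equalityI subsetI)
    fix u :: real assume u: "u \<in> {0<..<1}"
    \<comment> \<open>The preimage is half the logit of \<open>u\<close>, that is ln (u / (1 - u)) /
      2.\<close>
    then have "g (- ln (1 / u - 1) / 2) = u"
      by (simp add: g_def field_simps)
    then show "u \<in> range g" by (metis rangeI)
  qed (use nz in \<open>auto simp: g_def divide_less_eq\<close>)
  have "f absolutely_integrable_on {0<..<1}"
  proof (rule nonnegative_absolutely_integrable_1)
    show "f integrable_on {0<..<1}"
      using has_integral_Beta_real[OF assms]
      by (auto simp: f_def has_integral_Icc_iff_Ioo integrable_on_def)
  qed (auto simp: f_def)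
  moreover have "integral {0<..<1} f = Beta a b"
    using has_integral_Beta_real[OF assms]
    by (auto simp: f_def has_integral_Icc_iff_Ioo)
  ultimately have "(\<lambda>x. \<bar>g' x\<bar> * f (g x)) absolutely_integrable_on UNIV \<and>
      integral UNIV (\<lambda>x. \<bar>g' x\<bar> * f (g x)) = Beta a b"
    by (subst has_absolute_integral_change_of_variables_1') (use der inj range in auto)
  then have "((\<lambda>x. \<bar>g' x\<bar> * f (g x)) has_integral Beta a b) UNIV"
    by (simp add: absolutely_integrable_on_def has_integral_iff)
  moreover have "\<bar>g' t\<bar> * f (g t) = 2 / 2 powr (a + b) * (exp ((a - b) * t) / cosh t powr (a + b))" for t
  proof -
    have g: "g t = exp t / (2 * cosh t)" "1 - g t = exp (- t) / (2 * cosh t)"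
    proof -
      define e where "e = exp (- t)"
      have e: "e > 0" "exp t = 1 / e" "exp (- t) = e" "exp (- 2 * t) = e\<^sup>2"
        by (simp_all add: e_def exp_minus field_simps flip: exp_double exp_add)
      have "1 + e\<^sup>2 > 0" by (simp add: add_pos_nonneg)
      then show "g t = exp t / (2 * cosh t)" "1 - g t = exp (- t) / (2 * cosh t)"
        using e(1) unfolding g_def cosh_field_def e by (simp_all add: field_simps power2_eq_square)
    qed
    \<comment> \<open>The logistic differential equation: the Jacobian raises both exponents
      \<open>a - 1\<close> and \<open>b - 1\<close> by one.\<close>
    have "\<bar>g' t\<bar> = 2 * g t * (1 - g t)"
      using nz[of t] by (simp add: g'_def g_def power2_eq_square field_simps)
    then have "\<bar>g' t\<bar> * f (g t) = 2 * ((g t * g t powr (a - 1)) * ((1 - g t) * (1 - g t) powr (b - 1)))"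
      by (simp add: f_def)
    also have "\<dots> = 2 * (g t powr a * (1 - g t) powr b)"
    proof -
      have "g t \<ge> 0"
        unfolding g(1) by simp
      moreover have "1 - g t \<ge> 0"
        unfolding g(2) by simp
      ultimately show ?thesis by (simp add: powr_mult_base)
    qed
    also have "\<dots> = 2 * (exp (a * t) * exp (- b * t) / ((2 * cosh t) powr a * (2 * cosh t) powr b))"
      unfolding g(2) unfolding g(1) by (simp add: powr_divide exp_powr_real mult.commute)
    also have "\<dots> = 2 / 2 powr (a + b) * (exp ((a - b) * t) / cosh t powr (a + b))"
      by (simp add: powr_add powr_mult left_diff_distrib exp_diff exp_minus field_simps)
    finally show ?thesis .
  qed
  ultimately have "((\<lambda>t. 2 / 2 powr (a + b) * (exp ((a - b) * t) / cosh t powr (a + b))) has_integral Beta a b) UNIV"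
    by simp
  then have "((\<lambda>t. 2 powr (a + b) / 2 * (2 / 2 powr (a + b) * (exp ((a - b) * t) / cosh t powr (a + b))))
      has_integral (2 powr (a + b) / 2 * Beta a b)) UNIV"
    by (rule has_integral_mult_right)
  then have "((\<lambda>t. exp ((a - b) * t) / cosh t powr (a + b))
      has_integral (2 powr (a + b - 1) * Beta a b)) UNIV"
    by (simp add: powr_diff)
  \<comment> \<open>The integrand is nonnegative, so the gauge integral passes to the Lebesgue
    integral through the nonnegative integral.\<close>
  then have "(\<integral>\<^sup>+t. ennreal (exp ((a - b) * t) / cosh t powr (a + b)) \<partial>lborel) = ennreal (2 powr (a + b - 1) * Beta a b)"
    by (intro nn_integral_has_integral_lborel) (auto simp: cosh_def)
  moreover have "Beta a b > 0"
    using assms by (simp add: Beta_def Gamma_real_pos)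
  ultimately show ?thesis
    by (intro has_bochner_integral_nn_integral) (auto simp: cosh_def)
qed

lemma has_bochner_integral_even_half_line:
  fixes f :: "real \<Rightarrow> real"
  assumes f: "has_bochner_integral lborel f x" and even: "\<And>t. f (- t) = f t"
  shows "has_bochner_integral lborel (\<lambda>t. indicator {0..} t * f t) (x / 2)"
proof -
  have fi: "integrable lborel f" and x: "integral\<^sup>L lborel f = x"
    using f by (auto simp: has_bochner_integral_iff)
  have pos: "integrable lborel (\<lambda>t. indicator {0..} t * f t)"
    and neg: "integrable lborel (\<lambda>t. indicator {..0} t * f t)"
    using integrable_mult_indicator[OF _ fi, of "{0..}"] integrable_mult_indicator[OF _ fi, of "{..0}"]
    by auto
  have eq: "(\<integral>t. indicator {..0} t * f t \<partial>lborel) = (\<integral>t. indicator {0..} t * f t \<partial>lborel)"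
    using even by (subst lborel_integral_real_affine[of "-1" _ 0])
      (auto intro!: Bochner_Integration.integral_cong split: split_indicator)
  \<comment> \<open>Both closed half-lines contain 0, so the two integrands agree only almost
    everywhere.\<close>
  have "x = (\<integral>t. indicator {..0} t * f t + indicator {0..} t * f t \<partial>lborel)"
    unfolding x[symmetric] using AE_lborel_singleton[of 0] fi pos neg
    by (intro integral_cong_AE) (auto elim!: eventually_mono split: split_indicator)
  also have "\<dots> = 2 * (\<integral>t. indicator {0..} t * f t \<partial>lborel)"
    using pos neg eq by simp
  finally show ?thesis
    using pos by (simp add: has_bochner_integral_iff)
qed

text \<open>Averaging the exponential formula for \<open>(a, b)\<close> and \<open>(b, a)\<close>
  turns exp into cosh and keeps the value, since Beta is symmetric. The integrand is then even, and
  restricting to the half-line costs a further factor 2.\<close>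

lemma has_bochner_integral_cosh_powr_cosh:
  fixes a b :: real
  assumes "a > 0" "b > 0"
  shows "has_bochner_integral lborel
    (\<lambda>t. indicator {0..} t * (cosh ((a - b) * t) / cosh t powr (a + b)))
    (2 powr (a + b - 2) * Beta a b)"
proof -
  have "has_bochner_integral lborel
      (\<lambda>t. (exp ((a - b) * t) / cosh t powr (a + b) + exp ((b - a) * t) / cosh t powr (b + a)) / 2)
      ((2 powr (a + b - 1) * Beta a b + 2 powr (b + a - 1) * Beta b a) / 2)"
    using assms
    by (intro has_bochner_integral_divide_zero has_bochner_integral_add has_bochner_integral_cosh_powr_exp)
  also have "(\<lambda>t. (exp ((a - b) * t) / cosh t powr (a + b) + exp ((b - a) * t) / cosh t powr (b + a)) / 2)
      = (\<lambda>t. cosh ((a - b) * t) / cosh t powr (a + b))"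
    by (auto simp: fun_eq_iff cosh_field_def add.commute algebra_simps add_divide_distrib)
  also have "(2 powr (a + b - 1) * Beta a b + 2 powr (b + a - 1) * Beta b a) / 2 = 2 powr (a + b - 1) * Beta a b"
    by (simp add: Beta_commute add.commute)
  finally have "has_bochner_integral lborel
    (\<lambda>t. indicator {0..} t * (cosh ((a - b) * t) / cosh t powr (a + b)))
    (2 powr (a + b - 1) * Beta a b / 2)"
    by (rule has_bochner_integral_even_half_line) simp
  then show ?thesis
    by (simp add: powr_diff)
qed

section \<open>Mellin transform of the Bessel function\<close>

lemma borel_measurable_cosh [measurable]: "(cosh :: real \<Rightarrow> real) \<in> borel_measurable borel"
  by (intro borel_measurable_continuous_onI continuous_intros)

lemma borel_measurable_bessel_K [measurable]: "bessel_K \<nu> \<in> borel_measurable borel"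
  unfolding bessel_K_def set_lebesgue_integral_def by measurable

lemma bessel_K_nonneg: "bessel_K \<nu> x \<ge> 0"
  unfolding bessel_K_def set_lebesgue_integral_def
  by (intro integral_nonneg_AE) (auto simp: cosh_real_nonneg)

text \<open>Fubini for \<open>F\<close>: integrating over \<open>y\<close> first gives Gamma s /
  (\<alpha> cosh t) powr s, and the remaining integral over \<open>t\<close> is a Beta integral
  whose denominator cancels \<open>Gamma s\<close>.\<close>

lemma has_bochner_integral_Mellin_bessel_K:
  fixes \<nu> \<alpha> s :: real
  assumes \<alpha>: "\<alpha> > 0" and s: "s > \<bar>\<nu>\<bar>"
  shows "has_bochner_integral lborel
    (\<lambda>y. indicator {0<..} y * (y powr (s - 1) * bessel_K \<nu> (\<alpha> * y)))
    (2 powr (s - 2) / \<alpha> powr s * Gamma ((s + \<nu>) / 2) * Gamma ((s - \<nu>) / 2))"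
proof -
  define F :: "real \<Rightarrow> real \<Rightarrow> real" where "F = (\<lambda>t y. (indicator {0..} t * cosh (\<nu> * t)) *
    (indicator {0<..} y * (y powr (s - 1) * exp (- (\<alpha> * cosh t) * y))))"
  have s0: "s > 0" using s by simp
  have F_nonneg: "F t y \<ge> 0" for t y
    by (auto simp: F_def cosh_real_nonneg)
  have inner: "has_bochner_integral lborel (F t)
      (indicator {0..} t * cosh (\<nu> * t) * (Gamma s / (\<alpha> * cosh t) powr s))" for t
    unfolding F_def using \<alpha> s0
    by (intro has_bochner_integral_mult_right has_bochner_integral_Gamma_scaled) auto
  \<comment> \<open>Solves a - b = \<nu>, a + b = s; the condition s > \<bar>\<nu>\<bar> says
    exactly that both are positive.\<close>
  define a b where "a = (s + \<nu>) / 2" and "b = (s - \<nu>) / 2"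
  have ab: "a > 0" "b > 0" "a - b = \<nu>" "a + b = s"
    using s by (auto simp: a_def b_def field_simps)
  have "has_bochner_integral lborel
      (\<lambda>t. Gamma s / \<alpha> powr s * (indicator {0..} t * (cosh (\<nu> * t) / cosh t powr s)))
      (Gamma s / \<alpha> powr s * (2 powr (s - 2) * Beta a b))"
    using has_bochner_integral_cosh_powr_cosh[OF ab(1,2)]
    unfolding ab by (intro has_bochner_integral_mult_right)
  also have "(\<lambda>t. Gamma s / \<alpha> powr s * (indicator {0..} t * (cosh (\<nu> * t) / cosh t powr s))) =
      (\<lambda>t. \<integral>y. F t y \<partial>lborel)"
    using inner \<alpha> by (auto simp: has_bochner_integral_iff powr_mult fun_eq_iff)
  also have "Gamma s / \<alpha> powr s * (2 powr (s - 2) * Beta a b) =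
      2 powr (s - 2) / \<alpha> powr s * Gamma a * Gamma b"
    using ab s0 by (simp add: Beta_def Gamma_real_pos less_imp_neq[symmetric])
  finally have outer: "has_bochner_integral lborel (\<lambda>t. \<integral>y. F t y \<partial>lborel)
      (2 powr (s - 2) / \<alpha> powr s * Gamma a * Gamma b)" .
  \<comment> \<open>Since \<open>F\<close> is nonnegative, \<open>outer\<close> also gives the
    integrability of the iterated integral of its norm.\<close>
  have int: "integrable (lborel \<Otimes>\<^sub>M lborel) (case_prod F)"
  proof (rule lborel_pair.Fubini_integrable)
    show "case_prod F \<in> borel_measurable (lborel \<Otimes>\<^sub>M lborel)"
      unfolding F_def by measurable
    show "integrable lborel (\<lambda>t. \<integral>y. norm (case (t, y) of (t, y) \<Rightarrow> F t y) \<partial>lborel)"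
      using outer F_nonneg by (simp add: has_bochner_integral_iff)
    show "AE t in lborel. integrable lborel (\<lambda>y. case (t, y) of (t, y) \<Rightarrow> F t y)"
      using inner by (simp add: has_bochner_integral_iff)
  qed
  \<comment> \<open>In the other order, the integral over \<open>t\<close> is the defining integral
    of \<open>bessel_K\<close>.\<close>
  have "(\<integral>t. F t y \<partial>lborel) = indicator {0<..} y * (y powr (s - 1) * bessel_K \<nu> (\<alpha> * y))" for y
  proof -
    have "F t y = (indicator {0<..} y * y powr (s - 1)) *
        (indicator {0..} t * (exp (- (\<alpha> * y) * cosh t) * cosh (\<nu> * t)))" for t
      by (simp add: F_def mult_ac)
    then show ?thesis
      by (simp add: bessel_K_def set_lebesgue_integral_def mult.assoc)
  qed
  moreover have "integrable lborel (\<lambda>y. \<integral>t. F t y \<partial>lborel)"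
    by (rule lborel_pair.integrable_snd[OF int])
  moreover have "(\<integral>y. (\<integral>t. F t y \<partial>lborel) \<partial>lborel) = 2 powr (s - 2) / \<alpha> powr s * Gamma a * Gamma b"
    using lborel_pair.Fubini_integral[OF int] outer by (simp add: has_bochner_integral_iff)
  ultimately show ?thesis
    by (simp add: has_bochner_integral_iff a_def b_def)
qed

section \<open>Hypergeometric and hyperbolic series\<close>

text \<open>Ratio test: the quotient of consecutive terms is (a + j)(b + j) z / ((c + j)(1 + j)),
  which tends to \<open>z\<close>. The midpoint of \<bar>z\<bar> and 1 serves as the ratio
  bound.\<close>

lemma summable_hyp2F1:
  fixes a b c z :: real
  assumes "c > 0" "\<bar>z\<bar> < 1"
  shows "summable (\<lambda>j. pochhammer a j * pochhammer b j / pochhammer c j * (z ^ j / fact j))"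
    (is "summable ?h")
proof -
  define x where "x = (\<bar>z\<bar> + 1) / 2"
  have x: "\<bar>z\<bar> < x" "x < 1" using assms by (auto simp: x_def)
  have "(\<lambda>j. (a + real j) * (b + real j) / ((c + real j) * (1 + real j)) * z) \<longlonglongrightarrow> z"
    by real_asymp
  then have "(\<lambda>j. \<bar>(a + real j) * (b + real j) / ((c + real j) * (1 + real j)) * z\<bar>) \<longlonglongrightarrow> \<bar>z\<bar>"
    by (rule tendsto_rabs)
  then have "\<forall>\<^sub>F j in sequentially. \<bar>(a + real j) * (b + real j) / ((c + real j) * (1 + real j)) * z\<bar> < x"
    using x by (intro order_tendstoD)
  then obtain N where N: "\<And>j. j \<ge> N \<Longrightarrow> \<bar>(a + real j) * (b + real j) / ((c + real j) * (1 + real j)) * z\<bar> < x"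
    by (auto simp: eventually_sequentially)
  show ?thesis
  proof (rule summable_ratio_test[OF x(2)])
    fix j assume "N \<le> j"
    define R where "R = (a + real j) * (b + real j) / ((c + real j) * (1 + real j)) * z"
    have "?h (Suc j) = R * ?h j"
      using assms by (simp add: R_def pochhammer_Suc mult_ac)
    then have "norm (?h (Suc j)) = \<bar>R\<bar> * norm (?h j)"
      by (simp only: real_norm_def abs_mult)
    also have "\<dots> \<le> x * norm (?h j)"
      using N[OF \<open>N \<le> j\<close>] by (intro mult_right_mono) (auto simp: R_def)
    finally show "norm (?h (Suc j)) \<le> x * norm (?h j)" .
  qed
qed

text \<open>Turns the factorials of the cosh series (\<open>q = 0\<close>) and the sinh series
  (\<open>q = 1\<close>) into the denominators j! and (1/2 + q)_j of the hypergeometric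
  series.\<close>

lemma fact_double_plus_parity:
  assumes "q \<le> (1::nat)"
  shows "(fact (2 * j + q) :: real) = 4 ^ j * fact j * pochhammer (1/2 + real q) j"
proof (cases "q = 0")
  case True
  then show ?thesis
    by (simp add: fact_double power_mult)
next
  case False
  then have [simp]: "q = 1" using assms by simp
  \<comment> \<open>Both sides are \<open>pochhammer (1/2) (Suc j)\<close>, split off at the first
    and at the last factor.\<close>
  have "(1/2 :: real) * pochhammer (3/2) j = (1/2 + real j) * pochhammer (1/2) j"
    using pochhammer_rec[of "1/2::real" j] pochhammer_Suc[of "1/2::real" j] by (simp add: mult.commute)
  then have 3: "pochhammer (3/2 :: real) j = (1 + 2 * real j) * pochhammer (1/2) j"
    by (simp add: algebra_simps)
  have "(fact (2 * j + q) :: real) = (1 + 2 * real j) * fact (2 * j)"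
    by simp
  then show ?thesis
    unfolding fact_double using 3 by (simp add: power_mult)
qed

text \<open>The limit is cosh x for even \<open>k\<close> and sinh x for odd \<open>k\<close>. The
  common form lets the moment computation treat both parities at once; reindexing drops the zero
  terms of the library series.\<close>

lemma sums_cosh_sinh:
  fixes x :: real
  shows "(\<lambda>j. x ^ (2 * j + k mod 2) / fact (2 * j + k mod 2)) sums ((exp x + (- 1) ^ k * exp (- x)) / 2)"
proof (cases "even k")
  case True
  have "(\<lambda>j. if even (2 * j) then x ^ (2 * j) /\<^sub>R fact (2 * j) else 0) sums cosh x"
    using cosh_converges[of x]
    by (subst sums_mono_reindex[of "\<lambda>j. 2 * j"]) (auto simp: strict_mono_def elim!: oddE)
  then show ?thesis
    using True by (simp add: cosh_field_def even_iff_mod_2_eq_zero field_simps)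
next
  case False
  have "n \<in> range (\<lambda>j. 2 * j + 1)" if "odd n" for n :: nat
    using that by (auto elim!: oddE)
  then have "(\<lambda>j. if even (2 * j + 1) then 0 else x ^ (2 * j + 1) /\<^sub>R fact (2 * j + 1)) sums sinh x"
    using sinh_converges[of x]
    by (subst sums_mono_reindex[of "\<lambda>j. 2 * j + 1"]) (auto simp: strict_mono_def)
  then show ?thesis
    using False by (simp add: sinh_field_def odd_iff_mod_2_eq_one field_simps)
qed

section \<open>Moments on the half-line by termwise integration\<close>

text \<open>The Mellin transform at s = 2n + \<nu> + 1. Its condition s > -\<nu> follows from 2\<nu>
  + 1 > 0.\<close>

lemma has_bochner_integral_even_moment_bessel_K:
  fixes \<nu> \<alpha> :: real
  assumes \<nu>: "\<nu> > - 1/2" and \<alpha>: "\<alpha> > 0"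
  shows "has_bochner_integral lborel
    (\<lambda>y. indicator {0<..} y * (y ^ (2 * n) * (y powr \<nu> * bessel_K \<nu> (\<alpha> * y))))
    ((2 / \<alpha>) ^ (2 * n) * (2 powr (\<nu> - 1) / \<alpha> powr (\<nu> + 1))
      * Gamma (\<nu> + (real n + 1/2)) * Gamma (real n + 1/2))"
proof -
  define s where "s = 2 * real n + \<nu> + 1"
  have "s > \<bar>\<nu>\<bar>" using \<nu> by (auto simp: s_def abs_if)
  from has_bochner_integral_Mellin_bessel_K[OF \<alpha> this]
  have "has_bochner_integral lborel
    (\<lambda>y. indicator {0<..} y * (y powr (s - 1) * bessel_K \<nu> (\<alpha> * y)))
    (2 powr (s - 2) / \<alpha> powr s * Gamma ((s + \<nu>) / 2) * Gamma ((s - \<nu>) / 2))" .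
  also have "(\<lambda>y. indicator {0<..} y * (y powr (s - 1) * bessel_K \<nu> (\<alpha> * y))) =
      (\<lambda>y. indicator {0<..} y * (y ^ (2 * n) * (y powr \<nu> * bessel_K \<nu> (\<alpha> * y))))"
    by (auto simp: fun_eq_iff s_def powr_add powr_realpow[of _ "2 * n", simplified] split: split_indicator)
  also have "2 powr (s - 2) = 2 ^ (2 * n) * 2 powr (\<nu> - 1)"
  proof -
    have "s - 2 = real (2 * n) + (\<nu> - 1)" by (simp add: s_def)
    then show ?thesis by (simp only: powr_add powr_realpow[of 2] zero_less_numeral)
  qed
  also have "\<alpha> powr s = \<alpha> ^ (2 * n) * \<alpha> powr (\<nu> + 1)"
  proof -
    have "s = real (2 * n) + (\<nu> + 1)" by (simp add: s_def)
    then show ?thesis by (simp only: powr_add[of _ "real (2 * n)"] powr_realpow[OF \<alpha>])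
  qed
  also have "(s + \<nu>) / 2 = \<nu> + (real n + 1/2)"
    by (simp add: s_def field_simps)
  also have "(s - \<nu>) / 2 = real n + 1/2"
    by (simp add: s_def field_simps)
  finally show ?thesis
    by (simp add: power_divide)
qed

text \<open>Since 2n = k + q, multiplying y^k by the term of degree 2j + q of cosh or sinh gives the
  even power y^(2(n + j)). Each term is thus an even moment, and the moments sum to the
  hypergeometric series.\<close>

lemma has_bochner_integral_moment_bessel_K_parity:
  fixes \<nu> \<alpha> \<beta> :: real and k :: nat
  assumes \<nu>: "\<nu> > - 1/2" and \<beta>: "\<bar>\<beta>\<bar> < \<alpha>"
  defines "q \<equiv> k mod 2" and "n \<equiv> (k + 1) div 2"
  shows "has_bochner_integral lborel
    (\<lambda>y. indicator {0<..} y * (y ^ k * ((exp (\<beta> * y) + (- 1) ^ k * exp (- (\<beta> * y))) / 2) *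
       (y powr \<nu> * bessel_K \<nu> (\<alpha> * y))))
    (\<beta> ^ q * ((2 / \<alpha>) ^ (2 * n) * (2 powr (\<nu> - 1) / \<alpha> powr (\<nu> + 1))
      * Gamma (\<nu> + (real n + 1/2)) * Gamma (real n + 1/2)) *
      hyp2F1 (real n + 1/2) (\<nu> + (real n + 1/2)) (1/2 + real q) (\<beta>\<^sup>2 / \<alpha>\<^sup>2))"
proof -
  define V where "V = (\<lambda>n. (2 / \<alpha>) ^ (2 * n) * (2 powr (\<nu> - 1) / \<alpha> powr (\<nu> + 1))
      * Gamma (\<nu> + (real n + 1/2)) * Gamma (real n + 1/2))"
  define w where "w = (\<lambda>y. y powr \<nu> * bessel_K \<nu> (\<alpha> * y))"
  define p where "p = real n + 1/2"
  define z where "z = \<beta>\<^sup>2 / \<alpha>\<^sup>2"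
  define h where "h = (\<lambda>j. pochhammer p j * pochhammer (\<nu> + p) j / pochhammer (1/2 + real q) j * (z ^ j / fact j))"
  \<comment> \<open>The j-th term of the expansion. It takes a parameter \<gamma> because the norm
    of the term for \<beta> is the term for \<bar>\<beta>\<bar>.\<close>
  define T where "T = (\<lambda>\<gamma> j y. \<gamma> ^ (2 * j + q) / fact (2 * j + q) *
      (indicator {0<..} y * (y ^ (2 * (n + j)) * w y)))"
  have \<alpha>: "\<alpha> > 0" using \<beta> by linarith
  have kq: "2 * n = k + q" by (simp add: n_def q_def) presburger
  have q: "q \<le> 1" by (simp add: q_def)
  have z: "\<bar>z\<bar> < 1"
    using \<beta> \<alpha> by (auto simp: z_def power_divide[symmetric] abs_square_less_1)
  have w_nonneg: "w y \<ge> 0" for y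
    by (simp add: w_def bessel_K_nonneg)
  have coeff: "\<gamma> ^ (2 * j + q) / fact (2 * j + q) * V (n + j) = \<gamma> ^ q * V n * h j"
    if "\<gamma>\<^sup>2 = \<beta>\<^sup>2" for j \<gamma>
  proof -
    have "p > 0" "\<nu> + p > 0" using \<nu> by (auto simp: p_def)
    moreover have "Gamma (x + real j) = Gamma x * pochhammer x j" if "x > 0" for x
      using that nonpos_Ints_nonpos[of x] Gamma_real_pos[OF that]
      by (subst pochhammer_Gamma) (auto simp del: Gamma_real_pos)
    ultimately have G: "Gamma (p + real j) = Gamma p * pochhammer p j"
      "Gamma (\<nu> + p + real j) = Gamma (\<nu> + p) * pochhammer (\<nu> + p) j"
      by blast+
    have "V (n + j) = (2 / \<alpha>) ^ (2 * n) * (2 / \<alpha>) ^ (2 * j) * (2 powr (\<nu> - 1) / \<alpha> powr (\<nu> + 1))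
      * Gamma (\<nu> + p + real j) * Gamma (p + real j)"
      by (simp add: V_def p_def power_add algebra_simps)
    also have "\<dots> = V n * ((2 / \<alpha>) ^ (2 * j) * pochhammer p j * pochhammer (\<nu> + p) j)"
      unfolding G by (simp add: V_def p_def)
    finally have V: "V (n + j) = V n * ((2 / \<alpha>) ^ (2 * j) * pochhammer p j * pochhammer (\<nu> + p) j)" .
    have "\<gamma> ^ (2 * j + q) / fact (2 * j + q) * V (n + j) = (\<gamma> ^ (2 * j + q) * (2 / \<alpha>) ^ (2 * j)) *
        (V n * (pochhammer p j * pochhammer (\<nu> + p) j)) / fact (2 * j + q)"
      unfolding V by simp
    also have "\<gamma> ^ (2 * j + q) * (2 / \<alpha>) ^ (2 * j) = \<gamma> ^ q * 4 ^ j * z ^ j"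
      by (simp add: power_add power_mult that z_def power_divide)
    finally show ?thesis
      unfolding fact_double_plus_parity[OF q] by (simp add: h_def mult_ac)
  qed
  have T: "has_bochner_integral lborel (T \<gamma> j) (\<gamma> ^ q * V n * h j)" if "\<gamma>\<^sup>2 = \<beta>\<^sup>2" for \<gamma> j
    unfolding coeff[OF that, symmetric] unfolding T_def V_def w_def
    by (intro has_bochner_integral_mult_right has_bochner_integral_even_moment_bessel_K \<nu> \<alpha>)
  have norm_T: "norm (T \<gamma> j y) = T \<bar>\<gamma>\<bar> j y" for \<gamma> j y
    by (simp add: T_def abs_mult power_abs w_nonneg split: split_indicator)
  have h: "summable h"
    unfolding h_def using z by (intro summable_hyp2F1) auto
  have T_sums: "(\<lambda>j. T \<gamma> j y) sums (indicator {0<..} y *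
      (y ^ k * ((exp (\<gamma> * y) + (- 1) ^ k * exp (- (\<gamma> * y))) / 2) * w y))" for \<gamma> y
  proof -
    have "T \<gamma> j y = (indicator {0<..} y * y ^ k * w y) * ((\<gamma> * y) ^ (2 * j + q) / fact (2 * j + q))" for j
    proof -
      have "2 * (n + j) = k + (2 * j + q)" using kq by simp
      then show ?thesis unfolding T_def by (simp only: power_add power_mult_distrib) simp
    qed
    then show ?thesis
      using sums_mult[OF sums_cosh_sinh[of "\<gamma> * y" k], of "indicator {0<..} y * y ^ k * w y"]
      by (simp add: q_def mult_ac)
  qed
  have int: "integrable lborel (T \<beta> j)" for j
    using T[OF refl] by (auto simp: has_bochner_integral_iff)
  have AE: "AE y in lborel. summable (\<lambda>j. norm (T \<beta> j y))"
    unfolding norm_T using T_sums by (auto intro: sums_summable)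
  \<comment> \<open>The integrals of the norms are a constant multiple of the same convergent series
    \<open>h\<close>, which justifies exchanging sum and integral.\<close>
  have norm_sum: "summable (\<lambda>j. \<integral>y. norm (T \<beta> j y) \<partial>lborel)"
  proof -
    have "(\<integral>y. norm (T \<beta> j y) \<partial>lborel) = \<bar>\<beta>\<bar> ^ q * V n * h j" for j
      unfolding norm_T using T[of "\<bar>\<beta>\<bar>" j] by (simp add: has_bochner_integral_iff)
    then show ?thesis
      using h by (simp add: summable_mult)
  qed
  have "(\<integral>y. T \<beta> j y \<partial>lborel) = \<beta> ^ q * V n * h j" for j
    using T[OF refl] by (auto simp: has_bochner_integral_iff)
  then have "(\<integral>y. (\<Sum>j. T \<beta> j y) \<partial>lborel) = \<beta> ^ q * V n * suminf h"
    using integral_suminf[OF int AE norm_sum] h by (simp add: suminf_mult)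
  moreover have "integrable lborel (\<lambda>y. \<Sum>j. T \<beta> j y)"
    by (rule integrable_suminf[OF int AE norm_sum])
  ultimately have "has_bochner_integral lborel (\<lambda>y. \<Sum>j. T \<beta> j y) (\<beta> ^ q * V n * suminf h)"
    by (simp add: has_bochner_integral_iff)
  then show ?thesis
    unfolding sums_unique[OF T_sums, symmetric]
    by (simp add: V_def w_def h_def hyp2F1_def p_def z_def)
qed

section \<open>Moments on the whole line\<close>

text \<open>Reflection carries the negative half-line to the positive one. Each half must be
  integrable by itself, as f y + f (-y) may be integrable through cancellation alone; f 0 = 0 makes
  the decomposition exact at every point.\<close>

lemma has_bochner_integral_fold_half_line:
  fixes f :: "real \<Rightarrow> real"
  assumes pos: "integrable lborel (\<lambda>y. indicator {0<..} y * f y)"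
    and neg: "integrable lborel (\<lambda>y. indicator {0<..} y * f (- y))"
    and sum: "has_bochner_integral lborel (\<lambda>y. indicator {0<..} y * (f y + f (- y))) I"
    and zero: "f 0 = 0"
  shows "has_bochner_integral lborel f I"
proof -
  define g where "g = (\<lambda>y. indicator {0<..} y * f (- y))"
  have f: "f = (\<lambda>y. indicator {0<..} y * f y + g (- y))"
    using zero by (auto simp: fun_eq_iff g_def not_less_iff_gr_or_eq split: split_indicator)
  have g: "integrable lborel g" unfolding g_def by (rule neg)
  have g': "integrable lborel (\<lambda>y. g (- y))"
    using lborel_integrable_real_affine[OF g, of "-1" 0] by simp
  have "(\<integral>y. g (- y) \<partial>lborel) = integral\<^sup>L lborel g"
    using lborel_integral_real_affine[of "-1" g 0] by simp
  then have "integral\<^sup>L lborel f = (\<integral>y. indicator {0<..} y * f y \<partial>lborel) + integral\<^sup>L lborel g"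
    by (subst f, subst Bochner_Integration.integral_add[OF pos g']) simp
  also have "\<dots> = (\<integral>y. indicator {0<..} y * f y + g y \<partial>lborel)"
    by (rule Bochner_Integration.integral_add[OF pos g, symmetric])
  also have "\<dots> = I"
    using sum by (simp add: has_bochner_integral_iff g_def distrib_left)
  finally show ?thesis
    using Bochner_Integration.integrable_add[OF pos g'] f by (simp add: has_bochner_integral_iff)
qed

text \<open>Folding at 0 gives twice the cosh or sinh integrand of the half-line moment. The
  separate halves are dominated by cosh-weighted moments of even order.\<close>

lemma has_bochner_integral_exp_moment_bessel_K:
  fixes \<nu> \<alpha> \<beta> :: real and k :: nat
  assumes \<nu>: "\<nu> > - 1/2" and \<beta>: "\<bar>\<beta>\<bar> < \<alpha>"
  defines "q \<equiv> k mod 2" and "n \<equiv> (k + 1) div 2"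
  shows "has_bochner_integral lborel
    (\<lambda>y. y ^ k * exp (\<beta> * y) * (\<bar>y\<bar> powr \<nu> * bessel_K \<nu> (\<alpha> * \<bar>y\<bar>)))
    (2 * (\<beta> ^ q * ((2 / \<alpha>) ^ (2 * n) * (2 powr (\<nu> - 1) / \<alpha> powr (\<nu> + 1))
      * Gamma (\<nu> + (real n + 1/2)) * Gamma (real n + 1/2)) *
      hyp2F1 (real n + 1/2) (\<nu> + (real n + 1/2)) (1/2 + real q) (\<beta>\<^sup>2 / \<alpha>\<^sup>2)))"
    (is "has_bochner_integral _ ?f (2 * ?I)")
proof -
  define w where "w = (\<lambda>y. y powr \<nu> * bessel_K \<nu> (\<alpha> * y))"
  define c where "c = (\<lambda>m y. indicator {0<..} y * (y ^ m * ((exp (\<beta> * y) + exp (- (\<beta> * y))) / 2) * w y))"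
  have w_nonneg: "w y \<ge> 0" for y
    by (simp add: w_def bessel_K_nonneg)
  have [measurable]: "w \<in> borel_measurable borel"
    unfolding w_def by measurable
  have c: "integrable lborel (c m)" if "even m" for m
    using has_bochner_integral_moment_bessel_K_parity[OF \<nu> \<beta>, of m] that
    by (simp add: c_def w_def has_bochner_integral_iff)
  have half: "integrable lborel (\<lambda>y. indicator {0<..} y * (y ^ k * exp (\<gamma> * y) * w y))"
    if "\<gamma> = \<beta> \<or> \<gamma> = - \<beta>" for \<gamma>
  proof (rule Bochner_Integration.integrable_bound)
    \<comment> \<open>The orders 0 and 2k are even for every \<open>k\<close>, so the dominating
      function always carries the cosh weight, which bounds both exponentials.\<close>
    show "integrable lborel (\<lambda>y. 2 * c 0 y + 2 * c (2 * k) y)"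
      using c by auto
    show "(\<lambda>y. indicator {0<..} y * (y ^ k * exp (\<gamma> * y) * w y)) \<in> borel_measurable lborel"
      by measurable
    show "AE y in lborel. norm (indicator {0<..} y * (y ^ k * exp (\<gamma> * y) * w y))
        \<le> norm (2 * c 0 y + 2 * c (2 * k) y)"
    proof (rule AE_I2)
      fix y :: real
      show "norm (indicator {0<..} y * (y ^ k * exp (\<gamma> * y) * w y)) \<le> norm (2 * c 0 y + 2 * c (2 * k) y)"
      proof (cases "y > 0")
        case True
        \<comment> \<open>Expanded, this is twice 1 + y^(2k) - y^k.\<close>
        have "0 \<le> (y ^ k - 1)\<^sup>2 + 1 + (y ^ k)\<^sup>2" by simp
        then have 1: "y ^ k \<le> 1 + y ^ (2 * k)"
          by (simp add: power2_diff power_even_eq)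
        have 2: "exp (\<gamma> * y) \<le> exp (\<beta> * y) + exp (- (\<beta> * y))"
          using that by auto
        have "y ^ k * exp (\<gamma> * y) * w y \<le> (1 + y ^ (2 * k)) * (exp (\<beta> * y) + exp (- (\<beta> * y))) * w y"
          using True 1 2 w_nonneg by (intro mult_right_mono mult_mono) auto
        also have "\<dots> = 2 * c 0 y + 2 * c (2 * k) y"
          using True by (simp add: c_def algebra_simps add_divide_distrib)
        finally show ?thesis
          using True w_nonneg[of y] by (simp add: abs_mult)
      qed (simp add: c_def)
    qed
  qed
  show ?thesis
  proof (rule has_bochner_integral_fold_half_line)
    have 1: "(\<lambda>y. indicator {0<..} y * ?f y) = (\<lambda>y. indicator {0<..} y * (y ^ k * exp (\<beta> * y) * w y))"
      by (auto simp: fun_eq_iff w_def split: split_indicator)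
    show "integrable lborel (\<lambda>y. indicator {0<..} y * ?f y)"
      unfolding 1 by (rule half) simp
    have 2: "(\<lambda>y. indicator {0<..} y * ?f (- y)) =
        (\<lambda>y. (- 1) ^ k * (indicator {0<..} y * (y ^ k * exp (- \<beta> * y) * w y)))"
    proof
      fix y
      show "indicator {0<..} y * ?f (- y) = (- 1) ^ k * (indicator {0<..} y * (y ^ k * exp (- \<beta> * y) * w y))"
        using power_minus[of y k] by (auto simp: w_def split: split_indicator)
    qed
    show "integrable lborel (\<lambda>y. indicator {0<..} y * ?f (- y))"
      unfolding 2 by (intro integrable_mult_right half) simp
    have 3: "(\<lambda>y. indicator {0<..} y * (?f y + ?f (- y))) = (\<lambda>y. 2 * (indicator {0<..} y *
        (y ^ k * ((exp (\<beta> * y) + (- 1) ^ k * exp (- (\<beta> * y))) / 2) * (y powr \<nu> * bessel_K \<nu> (\<alpha> * y)))))"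
    proof
      fix y
      show "indicator {0<..} y * (?f y + ?f (- y)) = 2 * (indicator {0<..} y *
          (y ^ k * ((exp (\<beta> * y) + (- 1) ^ k * exp (- (\<beta> * y))) / 2) * (y powr \<nu> * bessel_K \<nu> (\<alpha> * y))))"
        using power_minus[of y k] by (auto simp: algebra_simps split: split_indicator)
    qed
    show "has_bochner_integral lborel (\<lambda>y. indicator {0<..} y * (?f y + ?f (- y))) (2 * ?I)"
      unfolding 3 q_def n_def
      by (intro has_bochner_integral_mult_right has_bochner_integral_moment_bessel_K_parity \<nu> \<beta>)
  qed simp
qed

section \<open>Moments of the variance-gamma law\<close>

lemma vg_p_conv: "vg_p k = real ((k + 1) div 2) + 1/2"
proof -
  have "\<lceil>real k / 2\<rceil> = int ((k + 1) div 2)"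
    by (rule ceiling_unique) linarith+
  then show ?thesis by (simp add: vg_p_def)
qed

lemma vg_central_moment:
  fixes \<nu> \<alpha> \<beta> \<mu> :: real and k :: nat
  assumes \<nu>: "\<nu> > - 1/2" and \<beta>: "\<bar>\<beta>\<bar> < \<alpha>"
  shows "has_bochner_integral lborel (\<lambda>y. vg_density \<nu> \<alpha> \<beta> \<mu> (\<mu> + y) * y ^ k)
    ((1 - \<beta>\<^sup>2 / \<alpha>\<^sup>2) powr (\<nu> + 1/2) / (sqrt pi * Gamma (\<nu> + 1/2)) *
      ((2 / \<alpha>) ^ k * (2 * \<beta> / \<alpha>) ^ vg_q k * Gamma (\<nu> + vg_p k) * Gamma (vg_p k) *
        hyp2F1 (vg_p k) (\<nu> + vg_p k) (1/2 + real (vg_q k)) (\<beta>\<^sup>2 / \<alpha>\<^sup>2)))"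
proof -
  define n q where "n = (k + 1) div 2" and "q = k mod 2"
  have kq: "2 * n = k + q" by (simp add: n_def q_def) presburger
  have \<alpha>: "\<alpha> > 0" using \<beta> by linarith
  define C where "C = (\<alpha>\<^sup>2 - \<beta>\<^sup>2) powr (\<nu> + 1/2) / (sqrt pi * (2 * \<alpha>) powr \<nu> * Gamma (\<nu> + 1/2))"
  have sq: "\<beta>\<^sup>2 < \<alpha>\<^sup>2"
    using power_strict_mono[OF \<beta>, of 2] by simp
  have "\<alpha>\<^sup>2 - \<beta>\<^sup>2 = \<alpha>\<^sup>2 * (1 - \<beta>\<^sup>2 / \<alpha>\<^sup>2)"
    using \<alpha> by (simp add: field_simps)
  then have "(\<alpha>\<^sup>2 - \<beta>\<^sup>2) powr (\<nu> + 1/2) = (\<alpha>\<^sup>2) powr (\<nu> + 1/2) * (1 - \<beta>\<^sup>2 / \<alpha>\<^sup>2) powr (\<nu> + 1/2)"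
    using sq \<alpha> by (simp add: powr_mult)
  \<comment> \<open>One factor cancels the \<alpha> powr \<nu> in the normalisation of the density,
    the other the denominator of the Bessel moment.\<close>
  also have "(\<alpha>\<^sup>2) powr (\<nu> + 1/2) = \<alpha> powr \<nu> * \<alpha> powr (\<nu> + 1)"
  proof -
    have "(\<alpha>\<^sup>2) powr (\<nu> + 1/2) = (\<alpha> powr 2) powr (\<nu> + 1/2)"
      using \<alpha> by simp
    also have "\<dots> = \<alpha> powr (\<nu> + (\<nu> + 1))"
      by (simp only: powr_powr) (simp add: algebra_simps)
    finally show ?thesis by (simp only: powr_add)
  qed
  finally have C: "C * (2 * (2 powr (\<nu> - 1) / \<alpha> powr (\<nu> + 1))) =
      (1 - \<beta>\<^sup>2 / \<alpha>\<^sup>2) powr (\<nu> + 1/2) / (sqrt pi * Gamma (\<nu> + 1/2))"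
    using \<alpha> by (simp add: C_def powr_mult powr_diff)
  \<comment> \<open>The surplus factor (2 / \<alpha>)^q from 2n = k + q joins \<beta>^q.\<close>
  have pow: "\<beta> ^ q * (2 / \<alpha>) ^ (2 * n) = (2 / \<alpha>) ^ k * (2 * \<beta> / \<alpha>) ^ q"
    unfolding kq by (simp add: power_add power_mult_distrib power_divide)
  have const: "C * (2 * (\<beta> ^ q * ((2 / \<alpha>) ^ (2 * n) * (2 powr (\<nu> - 1) / \<alpha> powr (\<nu> + 1)) * G * G') * H)) =
      (1 - \<beta>\<^sup>2 / \<alpha>\<^sup>2) powr (\<nu> + 1/2) / (sqrt pi * Gamma (\<nu> + 1/2)) *
      ((2 / \<alpha>) ^ k * (2 * \<beta> / \<alpha>) ^ q * G * G' * H)" for G G' H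
    unfolding C[symmetric]
    using arg_cong[OF pow, of "\<lambda>u. C * (2 * (2 powr (\<nu> - 1) / \<alpha> powr (\<nu> + 1))) * u * (G * G' * H)"]
    by (simp only: mult_ac)
  have "has_bochner_integral lborel
      (\<lambda>y. C * (y ^ k * exp (\<beta> * y) * (\<bar>y\<bar> powr \<nu> * bessel_K \<nu> (\<alpha> * \<bar>y\<bar>))))
      (C * (2 * (\<beta> ^ q * ((2 / \<alpha>) ^ (2 * n) * (2 powr (\<nu> - 1) / \<alpha> powr (\<nu> + 1))
      * Gamma (\<nu> + vg_p k) * Gamma (vg_p k)) *
      hyp2F1 (vg_p k) (\<nu> + vg_p k) (1/2 + real q) (\<beta>\<^sup>2 / \<alpha>\<^sup>2))))"
    unfolding vg_p_conv n_def q_def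
    by (intro has_bochner_integral_mult_right has_bochner_integral_exp_moment_bessel_K \<nu> \<beta>)
  also have "(\<lambda>y. C * (y ^ k * exp (\<beta> * y) * (\<bar>y\<bar> powr \<nu> * bessel_K \<nu> (\<alpha> * \<bar>y\<bar>)))) =
      (\<lambda>y. vg_density \<nu> \<alpha> \<beta> \<mu> (\<mu> + y) * y ^ k)"
    by (simp add: vg_density_def C_def fun_eq_iff)
  finally show ?thesis
    unfolding const by (simp add: vg_q_def q_def)
qed

theorem proposition2p1:
  fixes M :: "'a measure" and X :: "'a \<Rightarrow> real"
    and \<nu> \<alpha> \<beta> \<mu> :: real and r :: nat
  assumes "prob_space M"
    and "\<nu> > - 1/2" and "0 \<le> \<bar>\<beta>\<bar>" and "\<bar>\<beta>\<bar> < \<alpha>"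
    and "distributed M lborel X (\<lambda>x. ennreal (vg_density \<nu> \<alpha> \<beta> \<mu> x))"
    and "even r" and "r \<ge> 2"
  shows "integrable M (\<lambda>\<omega>. \<bar>X \<omega>\<bar> ^ r) \<and>
    prob_space.expectation M (\<lambda>\<omega>. \<bar>X \<omega>\<bar> ^ r) =
      (1 - \<beta>\<^sup>2 / \<alpha>\<^sup>2) powr (\<nu> + 1/2) / (sqrt pi * \<alpha> ^ r * Gamma (\<nu> + 1/2)) *
      (\<Sum>k=0..r. real (r choose k) * 2 ^ k * (\<alpha> * \<mu>) ^ (r - k) * (2 * \<beta> / \<alpha>) ^ vg_q k
         * Gamma (\<nu> + vg_p k) * Gamma (vg_p k)
         * hyp2F1 (vg_p k) (\<nu> + vg_p k) (1/2 + real (vg_q k)) (\<beta>\<^sup>2 / \<alpha>\<^sup>2))"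
proof -
  define A where "A = (1 - \<beta>\<^sup>2 / \<alpha>\<^sup>2) powr (\<nu> + 1/2) / (sqrt pi * Gamma (\<nu> + 1/2))"
  define H where "H = (\<lambda>k. (2 * \<beta> / \<alpha>) ^ vg_q k * Gamma (\<nu> + vg_p k) * Gamma (vg_p k)
         * hyp2F1 (vg_p k) (\<nu> + vg_p k) (1/2 + real (vg_q k)) (\<beta>\<^sup>2 / \<alpha>\<^sup>2))"
  define f where "f = vg_density \<nu> \<alpha> \<beta> \<mu>"
  have \<alpha>: "\<alpha> > 0" using assms by linarith
  \<comment> \<open>\<open>ennreal\<close> truncates negative values, so nonnegativity is what
    identifies \<open>f\<close> with the density of the law.\<close>
  have f_nonneg: "f x \<ge> 0" for x
    using \<open>\<nu> > - 1/2\<close> by (simp add: f_def vg_density_def bessel_K_nonneg Gamma_real_pos less_imp_le)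
  have summand: "has_bochner_integral lborel (\<lambda>y. real (r choose k) * \<mu> ^ (r - k) * (f (\<mu> + y) * y ^ k))
      (real (r choose k) * \<mu> ^ (r - k) * (A * ((2 / \<alpha>) ^ k * H k)))" for k
    using vg_central_moment[OF assms(2,4), of \<mu> k] unfolding f_def A_def H_def
    by (intro has_bochner_integral_mult_right) (simp add: mult.assoc)
  have "has_bochner_integral lborel (\<lambda>y. \<Sum>k=0..r. real (r choose k) * \<mu> ^ (r - k) * (f (\<mu> + y) * y ^ k))
      (\<Sum>k=0..r. real (r choose k) * \<mu> ^ (r - k) * (A * ((2 / \<alpha>) ^ k * H k)))"
    by (rule has_bochner_integral_sum) (rule summand)
  \<comment> \<open>As \<open>r\<close> is even, the absolute value disappears and the binomial
    theorem applies. The form \<mu> + 1 * y matches the affine substitution used afterwards.\<close>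
  also have "(\<lambda>y. \<Sum>k=0..r. real (r choose k) * \<mu> ^ (r - k) * (f (\<mu> + y) * y ^ k)) =
      (\<lambda>y. f (\<mu> + 1 * y) * \<bar>\<mu> + 1 * y\<bar> ^ r)"
  proof
    fix y
    have "\<bar>\<mu> + 1 * y\<bar> ^ r = (y + \<mu>) ^ r"
      using \<open>even r\<close> by (simp add: power_even_abs add.commute)
    also have "\<dots> = (\<Sum>k=0..r. real (r choose k) * y ^ k * \<mu> ^ (r - k))"
      by (simp add: binomial_ring atLeast0AtMost)
    finally show "(\<Sum>k=0..r. real (r choose k) * \<mu> ^ (r - k) * (f (\<mu> + y) * y ^ k)) =
        f (\<mu> + 1 * y) * \<bar>\<mu> + 1 * y\<bar> ^ r"
      by (simp add: sum_distrib_left mult_ac)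
  qed
  also have "(\<Sum>k=0..r. real (r choose k) * \<mu> ^ (r - k) * (A * ((2 / \<alpha>) ^ k * H k))) =
      A / \<alpha> ^ r * (\<Sum>k=0..r. real (r choose k) * 2 ^ k * (\<alpha> * \<mu>) ^ (r - k) * H k)"
    unfolding sum_distrib_left
  proof (rule sum.cong[OF refl])
    fix k assume "k \<in> {0..r}"
    \<comment> \<open>The global factor 1 / \<alpha>^r provides the \<alpha>^k under 2^k and leaves
      \<alpha>^(r - k) to join \<mu>^(r - k).\<close>
    then have "\<alpha> ^ r = \<alpha> ^ k * \<alpha> ^ (r - k)" by (simp flip: power_add)
    then show "real (r choose k) * \<mu> ^ (r - k) * (A * ((2 / \<alpha>) ^ k * H k)) =
        A / \<alpha> ^ r * (real (r choose k) * 2 ^ k * (\<alpha> * \<mu>) ^ (r - k) * H k)"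
      using \<alpha> by (simp add: power_divide power_mult_distrib)
  qed
  finally have "has_bochner_integral lborel (\<lambda>y. f (\<mu> + 1 * y) * \<bar>\<mu> + 1 * y\<bar> ^ r)
      (A / \<alpha> ^ r * (\<Sum>k=0..r. real (r choose k) * 2 ^ k * (\<alpha> * \<mu>) ^ (r - k) * H k))" .
  then have "has_bochner_integral lborel (\<lambda>x. f x * \<bar>x\<bar> ^ r)
      (A / \<alpha> ^ r * (\<Sum>k=0..r. real (r choose k) * 2 ^ k * (\<alpha> * \<mu>) ^ (r - k) * H k))"
    by (subst lborel_has_bochner_integral_real_affine_iff[of 1 _ _ \<mu>]) auto
  \<comment> \<open>Integrability and expectation on \<open>M\<close> are carried over from the
    density by the law of \<open>X\<close>.\<close>
  moreover have "integrable lborel (\<lambda>x. f x * \<bar>x\<bar> ^ r) \<longleftrightarrow> integrable M (\<lambda>\<omega>. \<bar>X \<omega>\<bar> ^ r)"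
    using assms(5) f_nonneg unfolding f_def by (intro distributed_integrable) auto
  moreover have "(\<integral>x. f x * \<bar>x\<bar> ^ r \<partial>lborel) = (\<integral>\<omega>. \<bar>X \<omega>\<bar> ^ r \<partial>M)"
    using assms(5) f_nonneg unfolding f_def by (intro distributed_integral) auto
  ultimately show ?thesis
    by (simp add: has_bochner_integral_iff A_def H_def mult_ac)
qed

end
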